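(* Let $\mathbf G=(V,E)$ be a finite simple undirected graph with $V=\{1,\dots,n\}$. For $v\in V$ let $Z_{E(v)}$ be the product of the edge indeterminates $z_e$ over all edges $e\in E$ incident to $v$. If the edge indeterminates are nilpotent of degree $2$, i.e. $z_{uv}^2=0$ for all $uv\in E$, then the $n$ vertex monomials $Z_{E(1)},\dots,Z_{E(n)}$ form (generate) a nilpotent algebra whose nilpotent index $\eta(\mathbf G)$ is $$\eta(\mathbf G)=1+\alpha(\mathbf G),$$ where $\alpha(\mathbf G)$ is the order of a maximum independent set of $\mathbf G$.
   Context: An independent set of $\mathbf G$ is a subset of $V$ no two of whose vertices are adjacent; its order is its cardinality; a maximum independent set is one of the largest possible order. The edge indeterminates $z_{uv}$ ($uv\in E$) commute and are taken in $\mathbb C[z_{uv}:uv\in E]/(z_{uv}^2:uv\in E)$; the algebra in question is the (not necessarily unital) subalgebra generated by the vertex monomials. An empty product equals $1$. An algebra is nilpotent if there is an integer $k\ge1$ such that the product of any $k$ of its elements is zero; the nilpotent index is the smallest such $k$.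
   Formalization: The graph is assumed to have no isolated vertices: an isolated vertex has vertex monomial 1 (empty product), so the algebra contains 1 and is not nilpotent, and the claim fails for every such graph (e.g. n = 1, E empty). *)

theory Defs
  imports
    "HOL.Complex"
    "HOL-Algebra.Algebra"
    "HOL-Library.Poly_Mapping"
    "HOL-Library.Ramsey"
begin

text \<open>
  A finite simple graph on the vertex set \<open>V\<close> is given by its edge set, a subset of
  \<^term>\<open>[V]\<^bsup>2\<^esup>\<close>.
\<close>

definition independent_set :: "'v set \<Rightarrow> 'v set set \<Rightarrow> 'v set \<Rightarrow> bool" where
  "independent_set V E S \<longleftrightarrow> S \<subseteq> V \<and> (\<forall>u\<in>S. \<forall>v\<in>S. {u, v} \<notin> E)"

definition independence_number :: "'v set \<Rightarrow> 'v set set \<Rightarrow> nat" where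
  "independence_number V E = Max (card ` {S. independent_set V E S})"


text \<open>
  Polynomials are finitely supported maps from exponent vectors to coefficients; the carrier
  restricts the indeterminates to \<open>I\<close>, which makes the quotient below the ring
  \<open>C[x : x \<in> I] / (x\<^sup>2 : x \<in> I)\<close> with \<open>C\<close> the complex numbers.
\<close>

definition mpoly_ring :: "'x set \<Rightarrow> (('x \<Rightarrow>\<^sub>0 nat) \<Rightarrow>\<^sub>0 complex) ring" where
  "mpoly_ring I = \<lparr>carrier = {p. \<forall>m\<in>Poly_Mapping.keys p. Poly_Mapping.keys m \<subseteq> I},
     monoid.mult = (*), one = 1, ring.zero = 0, add = (+)\<rparr>"

definition mpoly_var :: "'x \<Rightarrow> ('x \<Rightarrow>\<^sub>0 nat) \<Rightarrow>\<^sub>0 complex" where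
  "mpoly_var x = Poly_Mapping.single (Poly_Mapping.single x 1) 1"

definition mpoly_const :: "complex \<Rightarrow> ('x \<Rightarrow>\<^sub>0 nat) \<Rightarrow>\<^sub>0 complex" where
  "mpoly_const c = Poly_Mapping.single 0 c"

definition square_ideal :: "'x set \<Rightarrow> (('x \<Rightarrow>\<^sub>0 nat) \<Rightarrow>\<^sub>0 complex) set" where
  "square_ideal I = Idl\<^bsub>mpoly_ring I\<^esub> ((\<lambda>x. mpoly_var x ^ 2) ` I)"

definition zeon_ring :: "'x set \<Rightarrow> (('x \<Rightarrow>\<^sub>0 nat) \<Rightarrow>\<^sub>0 complex) set ring" where
  "zeon_ring I = mpoly_ring I Quot square_ideal I"

definition zeon_class ::
    "'x set \<Rightarrow> (('x \<Rightarrow>\<^sub>0 nat) \<Rightarrow>\<^sub>0 complex) \<Rightarrow> (('x \<Rightarrow>\<^sub>0 nat) \<Rightarrow>\<^sub>0 complex) set" where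
  "zeon_class I p = square_ideal I +>\<^bsub>mpoly_ring I\<^esub> p"

definition zeon_scalars :: "'x set \<Rightarrow> (('x \<Rightarrow>\<^sub>0 nat) \<Rightarrow>\<^sub>0 complex) set set" where
  "zeon_scalars I = range (\<lambda>c. zeon_class I (mpoly_const c))"


text \<open>
  \<^const>\<open>subalgebra\<close> of HOL-Algebra only asserts closure under addition and under
  multiplication by the scalars in \<open>K\<close>; closure under the ring multiplication is added here.
  The result need not contain the unit.
\<close>

definition generated_algebra :: "'a set \<Rightarrow> 'a set \<Rightarrow> ('a, 'b) ring_scheme \<Rightarrow> 'a set" where
  "generated_algebra K S R =
     \<Inter>{A. subalgebra K A R \<and> (\<forall>a\<in>A. \<forall>b\<in>A. a \<otimes>\<^bsub>R\<^esub> b \<in> A) \<and> S \<subseteq> A}"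

definition products_vanish :: "('a, 'b) ring_scheme \<Rightarrow> 'a set \<Rightarrow> nat \<Rightarrow> bool" where
  "products_vanish R A k \<longleftrightarrow> (\<forall>f\<in>{..<k} \<rightarrow> A. finprod R f {..<k} = \<zero>\<^bsub>R\<^esub>)"

definition nilpotent_algebra :: "('a, 'b) ring_scheme \<Rightarrow> 'a set \<Rightarrow> bool" where
  "nilpotent_algebra R A \<longleftrightarrow> (\<exists>k\<ge>1. products_vanish R A k)"

text \<open>Only meaningful for nilpotent \<open>A\<close>.\<close>

definition nilpotent_index :: "('a, 'b) ring_scheme \<Rightarrow> 'a set \<Rightarrow> nat" where
  "nilpotent_index R A = (LEAST k. k \<ge> 1 \<and> products_vanish R A k)"


definition vertex_monomial ::
    "'v set set \<Rightarrow> 'v \<Rightarrow> (('v set \<Rightarrow>\<^sub>0 nat) \<Rightarrow>\<^sub>0 complex) set" where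
  "vertex_monomial E v =
     finprod (zeon_ring E) (\<lambda>e. zeon_class E (mpoly_var e)) {e \<in> E. v \<in> e}"

definition vertex_algebra ::
    "'v set \<Rightarrow> 'v set set \<Rightarrow> (('v set \<Rightarrow>\<^sub>0 nat) \<Rightarrow>\<^sub>0 complex) set set" where
  "vertex_algebra V E =
     generated_algebra (zeon_scalars E) (vertex_monomial E ` V) (zeon_ring E)"


text \<open>
  The vertex monomial of an isolated vertex is the empty product 1, and 1 is not nilpotent.
  Hence a graph with an isolated vertex never has a nilpotent vertex algebra.
\<close>

lemma cring_mpoly_ring: "cring (mpoly_ring I)"
proof -
  let ?C = "{p :: ('a \<Rightarrow>\<^sub>0 nat) \<Rightarrow>\<^sub>0 complex. \<forall>m\<in>Poly_Mapping.keys p. Poly_Mapping.keys m \<subseteq> I}"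
  have times: "p * q \<in> ?C" if p: "p \<in> ?C" and q: "q \<in> ?C" for p q
  proof -
    have "Poly_Mapping.keys m \<subseteq> I" if m: "m \<in> Poly_Mapping.keys (p * q)" for m
    proof -
      obtain a b where ab: "m = a + b" "a \<in> Poly_Mapping.keys p" "b \<in> Poly_Mapping.keys q"
        using subsetD[OF keys_mult m] by blast
      have "Poly_Mapping.keys a \<subseteq> I" "Poly_Mapping.keys b \<subseteq> I"
        using p q ab by blast+
      then show ?thesis
        using Poly_Mapping.keys_add[of a b] ab(1) by blast
    qed
    then show ?thesis by blast
  qed
  have plus: "p + q \<in> ?C" if "p \<in> ?C" "q \<in> ?C" for p q
    using that Poly_Mapping.keys_add[of p q] by blast
  have uminus: "- p \<in> ?C" if "p \<in> ?C" for p
    using that by simp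
  have zero: "0 \<in> ?C" and one: "1 \<in> ?C"
    by simp_all
  have "abelian_group (mpoly_ring I)"
    unfolding mpoly_ring_def
  proof (rule abelian_groupI, simp_all only: ring.simps monoid.simps partial_object.simps)
    fix p assume "p \<in> ?C"
    then show "\<exists>q\<in>?C. q + p = 0"
      by (intro bexI[of _ "- p"] uminus) simp_all
  qed (rule plus zero | assumption | simp only: ac_simps add_0 add_0_right)+
  moreover have "comm_monoid (mpoly_ring I)"
    unfolding mpoly_ring_def
    by (rule comm_monoidI, simp_all only: ring.simps monoid.simps partial_object.simps)
      (rule times one | assumption | simp only: ac_simps mult_1 mult_1_right)+
  ultimately show ?thesis
    by (rule cringI) (simp add: mpoly_ring_def distrib_right)
qed

lemma mpoly_var_square_in_carrier: "(\<lambda>x. mpoly_var x ^ 2) ` I \<subseteq> carrier (mpoly_ring I)"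
proof -
  interpret cring "mpoly_ring I" by (rule cring_mpoly_ring)
  have "mpoly_var x \<in> carrier (mpoly_ring I)" if "x \<in> I" for x
    using that by (simp add: mpoly_ring_def mpoly_var_def)
  then have "mpoly_var x \<otimes>\<^bsub>mpoly_ring I\<^esub> mpoly_var x \<in> carrier (mpoly_ring I)" if "x \<in> I" for x
    using that by blast
  then show ?thesis by (auto simp: mpoly_ring_def power2_eq_square)
qed

lemma ideal_square_ideal: "ideal (square_ideal I) (mpoly_ring I)"
proof -
  interpret cring "mpoly_ring I" by (rule cring_mpoly_ring)
  show ?thesis
    unfolding square_ideal_def by (rule genideal_ideal[OF mpoly_var_square_in_carrier])
qed

lemma lookup_mult_0:
  fixes p q :: "('x \<Rightarrow>\<^sub>0 nat) \<Rightarrow>\<^sub>0 complex"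
  assumes "Poly_Mapping.lookup p 0 = 0"
  shows "Poly_Mapping.lookup (p * q) 0 = 0"
proof -
  have "0 \<notin> Poly_Mapping.keys (p * q)"
  proof
    assume "0 \<in> Poly_Mapping.keys (p * q)"
    then obtain a b where ab: "0 = a + b" "a \<in> Poly_Mapping.keys p"
      using subsetD[OF keys_mult] by blast
    have "Poly_Mapping.lookup a x = 0" for x
      using arg_cong[OF ab(1), of "\<lambda>m. Poly_Mapping.lookup m x"] by (simp add: lookup_add)
    then have "a = 0" by (intro poly_mapping_eqI) simp
    then show False using ab(2) assms by (simp add: in_keys_iff)
  qed
  then show ?thesis by (simp add: in_keys_iff)
qed

lemma one_notin_square_ideal: "1 \<notin> square_ideal I"
proof -
  interpret cring "mpoly_ring I" by (rule cring_mpoly_ring)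
  define J where "J = {p \<in> carrier (mpoly_ring I). Poly_Mapping.lookup p 0 = 0}"
  have inv_eq: "\<ominus>\<^bsub>mpoly_ring I\<^esub> p = - p" if "p \<in> carrier (mpoly_ring I)" for p
    by (rule minus_equality) (use that in \<open>auto simp: mpoly_ring_def\<close>)
  have "ideal J (mpoly_ring I)"
  proof (rule idealI[OF ring_axioms])
    show "subgroup J (add_monoid (mpoly_ring I))"
    proof (rule add.subgroupI)
      show "J \<noteq> {}" by (auto simp: J_def mpoly_ring_def intro!: exI[of _ 0])
    next
      fix p assume "p \<in> J"
      then show "\<ominus>\<^bsub>mpoly_ring I\<^esub> p \<in> J"
        using inv_eq[of p] a_inv_closed[of p] by (simp add: J_def)
    next
      fix p q assume "p \<in> J" "q \<in> J"
      then show "p \<oplus>\<^bsub>mpoly_ring I\<^esub> q \<in> J"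
        using a_closed[of p q] by (simp add: J_def mpoly_ring_def lookup_add)
    qed (auto simp: J_def)
  next
    fix p q assume pq: "p \<in> J" "q \<in> carrier (mpoly_ring I)"
    have eq: "a \<otimes>\<^bsub>mpoly_ring I\<^esub> b = a * b" for a b
      by (simp add: mpoly_ring_def)
    show "p \<otimes>\<^bsub>mpoly_ring I\<^esub> q \<in> J"
      using m_closed[of p q] pq lookup_mult_0[of p q] by (simp add: J_def eq)
    then show "q \<otimes>\<^bsub>mpoly_ring I\<^esub> p \<in> J"
      by (simp add: eq mult.commute)
  qed
  moreover have "(\<lambda>x. mpoly_var x ^ 2) ` I \<subseteq> J"
  proof -
    have "Poly_Mapping.lookup (mpoly_var x) 0 = 0" for x :: 'a
      using single_zero[of x]
      by (auto simp: mpoly_var_def lookup_single when_def dest: arg_cong[of _ _ Poly_Mapping.keys])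
    then show ?thesis
      using mpoly_var_square_in_carrier[of I]
      by (auto simp: J_def power2_eq_square lookup_mult_0)
  qed
  ultimately have "square_ideal I \<subseteq> J"
    unfolding square_ideal_def by (rule genideal_minimal)
  moreover have "1 \<notin> J" by (simp add: J_def lookup_one)
  ultimately show ?thesis by blast
qed

lemma not_nilpotent_if_isolated:
  assumes "v \<in> V" and isolated: "\<forall>e\<in>E. v \<notin> e"
  shows "\<not> nilpotent_algebra (zeon_ring E) (vertex_algebra V E)"
proof
  interpret I: ideal "square_ideal E" "mpoly_ring E" by (rule ideal_square_ideal)
  interpret Q: cring "zeon_ring E"
    unfolding zeon_ring_def by (rule I.quotient_is_cring[OF cring_mpoly_ring])
  have "{e \<in> E. v \<in> e} = {}"
    using isolated by blast
  then have "vertex_monomial E v = \<one>\<^bsub>zeon_ring E\<^esub>"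
    unfolding vertex_monomial_def by (simp only: Q.finprod_empty)
  then have one: "\<one>\<^bsub>zeon_ring E\<^esub> \<in> vertex_algebra V E"
    using \<open>v \<in> V\<close> by (force simp: vertex_algebra_def generated_algebra_def)
  have nz: "\<one>\<^bsub>zeon_ring E\<^esub> \<noteq> \<zero>\<^bsub>zeon_ring E\<^esub>"
  proof
    assume eq: "\<one>\<^bsub>zeon_ring E\<^esub> = \<zero>\<^bsub>zeon_ring E\<^esub>"
    have "\<one>\<^bsub>mpoly_ring E\<^esub> \<in> square_ideal E +>\<^bsub>mpoly_ring E\<^esub> \<one>\<^bsub>mpoly_ring E\<^esub>"
      by (rule I.a_rcos_self) simp
    then show False
      using eq one_notin_square_ideal[of E]
      by (simp add: zeon_ring_def FactRing_def mpoly_ring_def)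
  qed
  assume "nilpotent_algebra (zeon_ring E) (vertex_algebra V E)"
  then obtain k where "products_vanish (zeon_ring E) (vertex_algebra V E) k"
    by (auto simp: nilpotent_algebra_def)
  then have "finprod (zeon_ring E) (\<lambda>_. \<one>\<^bsub>zeon_ring E\<^esub>) {..<k} = \<zero>\<^bsub>zeon_ring E\<^esub>"
    using one unfolding products_vanish_def by blast
  then show False using nz by (simp only: Q.finprod_one_eqI)
qed

end

theory Submission
  imports Defs
begin

text \<open>
  The squares of the indeterminates generate a monomial ideal. A polynomial vanishes in the
  quotient exactly when all its exponents fail to be squarefree, and everything reduces to the
  exponents of products of vertex monomials.

  Such a product is described by a multiset \<open>W\<close> of vertices. The exponent of an edge in it is the
  number of members of \<open>W\<close>, with multiplicity, that the edge contains. Suppose that this number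
  is at most one for every edge. Then no two distinct members of \<open>W\<close> are adjacent, and no vertex is
  repeated, because each vertex lies on some edge; so \<open>W\<close> is an independent set and has at most
  \<open>\<alpha>\<close> members. Conversely the vertex monomials of an independent set involve pairwise disjoint
  sets of edges, so their product is a nonzero squarefree monomial.

  Every element of the vertex algebra is the class of a combination of products of at least one
  vertex monomial. Hence a product of \<open>k\<close> elements is the class of a combination of products of at
  least \<open>k\<close> vertex monomials. For \<open>k > \<alpha>\<close> all of these vanish (\<open>products_vanish_above\<close>). For
  \<open>k \<le> \<alpha>\<close> the monomials of \<open>k\<close> vertices of a maximum independent set have a nonzero product
  (\<open>products_not_vanish_below\<close>).
\<close>

section \<open>Membership in the square ideal\<close>

definition squarefree_exponent :: "('x \<Rightarrow>\<^sub>0 nat) \<Rightarrow> bool" where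
  "squarefree_exponent m \<longleftrightarrow> (\<forall>x. Poly_Mapping.lookup m x \<le> 1)"

lemma squarefree_exponent_addD:
  assumes "squarefree_exponent (a + b)"
  shows "squarefree_exponent a"
  unfolding squarefree_exponent_def
proof
  fix x
  have "Poly_Mapping.lookup (a + b) x \<le> 1"
    using assms unfolding squarefree_exponent_def by blast
  then show "Poly_Mapping.lookup a x \<le> 1"
    by (simp add: lookup_add)
qed

lemma single_in_mpoly_ring:
  assumes "Poly_Mapping.keys m \<subseteq> I"
  shows "Poly_Mapping.single m c \<in> carrier (mpoly_ring I)"
  using assms by (simp add: mpoly_ring_def)

lemma mpoly_ring_a_inv:
  assumes "p \<in> carrier (mpoly_ring I)"
  shows "\<ominus>\<^bsub>mpoly_ring I\<^esub> p = - p"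
proof -
  interpret cring "mpoly_ring I" by (rule cring_mpoly_ring)
  show ?thesis
    by (rule minus_equality) (use assms in \<open>auto simp: mpoly_ring_def\<close>)
qed

lemma poly_mapping_sum_single:
  "(\<Sum>m\<in>Poly_Mapping.keys p. Poly_Mapping.single m (Poly_Mapping.lookup p m)) = p"
proof (rule poly_mapping_eqI)
  fix k
  have "Poly_Mapping.lookup
      (\<Sum>m\<in>Poly_Mapping.keys p. Poly_Mapping.single m (Poly_Mapping.lookup p m)) k
    = (\<Sum>m\<in>Poly_Mapping.keys p. if m = k then Poly_Mapping.lookup p m else 0)"
    by (simp add: lookup_sum lookup_single when_def)
  also have "\<dots> = Poly_Mapping.lookup p k"
    by (simp add: sum.delta' in_keys_iff)
  finally show "Poly_Mapping.lookup
      (\<Sum>m\<in>Poly_Mapping.keys p. Poly_Mapping.single m (Poly_Mapping.lookup p m)) k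
    = Poly_Mapping.lookup p k" .
qed

text \<open>
  A factor of a squarefree monomial is squarefree, so multiplication cannot repair a repeated
  indeterminate.
\<close>

lemma ideal_non_squarefree:
  "ideal {p \<in> carrier (mpoly_ring I). \<forall>m\<in>Poly_Mapping.keys p. \<not> squarefree_exponent m}
    (mpoly_ring I)" (is "ideal ?J _")
proof -
  interpret cring "mpoly_ring I" by (rule cring_mpoly_ring)
  have plus: "p \<oplus>\<^bsub>mpoly_ring I\<^esub> q = p + q" and times: "p \<otimes>\<^bsub>mpoly_ring I\<^esub> q = p * q" for p q
    by (simp_all add: mpoly_ring_def)
  have zero: "\<zero>\<^bsub>mpoly_ring I\<^esub> = 0"
    by (simp add: mpoly_ring_def)
  show ?thesis
  proof (rule idealI[OF ring_axioms])
    show "subgroup ?J (add_monoid (mpoly_ring I))"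
    proof (rule add.subgroupI)
      have "\<zero>\<^bsub>mpoly_ring I\<^esub> \<in> ?J"
        using zero_closed by (simp add: zero)
      then show "?J \<noteq> {}" by blast
    next
      fix p assume "p \<in> ?J"
      then show "\<ominus>\<^bsub>mpoly_ring I\<^esub> p \<in> ?J"
        using a_inv_closed[of p] by (simp add: mpoly_ring_a_inv)
    next
      fix p q assume "p \<in> ?J" "q \<in> ?J"
      then show "p \<oplus>\<^bsub>mpoly_ring I\<^esub> q \<in> ?J"
        using a_closed[of p q] keys_add[of p q] by (auto simp: plus)
    qed auto
  next
    fix p q assume pq: "p \<in> ?J" "q \<in> carrier (mpoly_ring I)"
    have "\<not> squarefree_exponent m" if m: "m \<in> Poly_Mapping.keys (p * q)" for m
      using subsetD[OF keys_mult m] pq(1) squarefree_exponent_addD by blast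
    then show "p \<otimes>\<^bsub>mpoly_ring I\<^esub> q \<in> ?J"
      using m_closed[of p q] pq by (simp add: times)
    then show "q \<otimes>\<^bsub>mpoly_ring I\<^esub> p \<in> ?J"
      by (simp add: times mult.commute)
  qed
qed

lemma mpoly_var_square: "mpoly_var x ^ 2 = Poly_Mapping.single (Poly_Mapping.single x 2) 1"
proof -
  have "Poly_Mapping.single x 1 + Poly_Mapping.single x 1 = Poly_Mapping.single x (2::nat)"
    by (metis single_add one_add_one)
  then show ?thesis
    by (simp add: mpoly_var_def power2_eq_square mult_single)
qed

lemma single_in_square_ideal:
  assumes m: "Poly_Mapping.keys m \<subseteq> I" and nsq: "\<not> squarefree_exponent m"
  shows "Poly_Mapping.single m c \<in> square_ideal I"
proof -
  interpret ideal "square_ideal I" "mpoly_ring I" by (rule ideal_square_ideal)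
  obtain x where x: "2 \<le> Poly_Mapping.lookup m x"
    using nsq unfolding squarefree_exponent_def by (metis Suc_1 not_less_eq_eq)
  define m' where "m' = m - Poly_Mapping.single x 2"
  \<comment> \<open>An indeterminate of exponent at least 2 lets one generator be split off.\<close>
  have m_eq: "m = Poly_Mapping.single x 2 + m'"
    using x by (intro poly_mapping_eqI) (auto simp: m'_def lookup_add lookup_minus lookup_single when_def)
  have "x \<in> I"
    using x m by (auto simp: in_keys_iff)
  then have "mpoly_var x ^ 2 \<in> (\<lambda>x. mpoly_var x ^ 2) ` I"
    by (rule imageI)
  then have gen: "mpoly_var x ^ 2 \<in> square_ideal I"
    unfolding square_ideal_def
    by (rule subsetD[OF ring.genideal_self[OF cring.axioms(1)[OF cring_mpoly_ring]
        mpoly_var_square_in_carrier]])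
  have "Poly_Mapping.keys m' \<subseteq> I"
    using m by (auto simp: m'_def in_keys_iff lookup_minus)
  then have "mpoly_var x ^ 2 \<otimes>\<^bsub>mpoly_ring I\<^esub> Poly_Mapping.single m' c \<in> square_ideal I"
    by (intro I_r_closed gen single_in_mpoly_ring)
  then show ?thesis
    by (simp add: mpoly_ring_def mpoly_var_square mult_single m_eq)
qed

text \<open>
  The polynomials on the right form an ideal that contains the generators, and each of their terms
  is a multiple of some generator. One inclusion makes long products vanish; the other shows that
  squarefree monomials survive in the quotient.
\<close>

lemma square_ideal_eq:
  "square_ideal I =
    {p \<in> carrier (mpoly_ring I). \<forall>m\<in>Poly_Mapping.keys p. \<not> squarefree_exponent m}"
proof (intro equalityI subsetI)
  interpret cring "mpoly_ring I" by (rule cring_mpoly_ring)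
  fix p assume "p \<in> square_ideal I"
  moreover have "\<not> squarefree_exponent (Poly_Mapping.single x 2)" for x :: 'a
    unfolding squarefree_exponent_def by (auto intro!: exI[of _ x])
  then have "square_ideal I \<subseteq>
    {p \<in> carrier (mpoly_ring I). \<forall>m\<in>Poly_Mapping.keys p. \<not> squarefree_exponent m}"
    unfolding square_ideal_def using mpoly_var_square_in_carrier[of I]
    by (intro genideal_minimal[OF ideal_non_squarefree]) (auto simp: mpoly_var_square)
  ultimately show
    "p \<in> {p \<in> carrier (mpoly_ring I). \<forall>m\<in>Poly_Mapping.keys p. \<not> squarefree_exponent m}"
    by blast
next
  interpret ideal "square_ideal I" "mpoly_ring I" by (rule ideal_square_ideal)
  fix p :: "('a \<Rightarrow>\<^sub>0 nat) \<Rightarrow>\<^sub>0 complex"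
  assume p: "p \<in> {p \<in> carrier (mpoly_ring I). \<forall>m\<in>Poly_Mapping.keys p. \<not> squarefree_exponent m}"
  have "(\<Sum>m\<in>A. Poly_Mapping.single m (Poly_Mapping.lookup p m)) \<in> square_ideal I"
    if "finite A" "A \<subseteq> Poly_Mapping.keys p" for A
    using that
  proof (induction A rule: finite_induct)
    case empty
    show ?case using additive_subgroup.zero_closed[OF additive_subgroup_axioms] by (simp add: mpoly_ring_def)
  next
    case (insert m A)
    have "Poly_Mapping.single m (Poly_Mapping.lookup p m) \<in> square_ideal I"
      using insert.prems p by (intro single_in_square_ideal) (auto simp: mpoly_ring_def)
    then show ?case
      using additive_subgroup.a_closed[OF additive_subgroup_axioms] insert
      by (simp add: mpoly_ring_def)
  qed
  from this[of "Poly_Mapping.keys p"] show "p \<in> square_ideal I"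
    by (simp add: poly_mapping_sum_single)
qed

section \<open>Residue classes of monomials\<close>

lemma zeon_class_hom: "ring_hom_cring (mpoly_ring I) (zeon_ring I) (zeon_class I)"
proof -
  have "zeon_class I = (+>\<^bsub>mpoly_ring I\<^esub>) (square_ideal I)"
    by (simp add: fun_eq_iff zeon_class_def)
  then show ?thesis
    unfolding zeon_ring_def
    using ideal.rcos_ring_hom_cring[OF ideal_square_ideal cring_mpoly_ring] by metis
qed

lemma zeon_class_eq_zero_iff:
  assumes p: "p \<in> carrier (mpoly_ring I)"
  shows "zeon_class I p = \<zero>\<^bsub>zeon_ring I\<^esub> \<longleftrightarrow> (\<forall>m\<in>Poly_Mapping.keys p. \<not> squarefree_exponent m)"
proof -
  interpret ideal "square_ideal I" "mpoly_ring I" by (rule ideal_square_ideal)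
  have "zeon_class I p = \<zero>\<^bsub>zeon_ring I\<^esub> \<longleftrightarrow> p \<in> square_ideal I"
    using rcos_const_imp_mem[OF p] a_rcos_zero[OF ideal_axioms]
    by (auto simp: zeon_class_def zeon_ring_def FactRing_def)
  also have "\<dots> \<longleftrightarrow> (\<forall>m\<in>Poly_Mapping.keys p. \<not> squarefree_exponent m)"
    unfolding square_ideal_eq using p by blast
  finally show ?thesis .
qed

lemma finprod_zeon_monomials:
  assumes "finite A" and "\<And>i. i \<in> A \<Longrightarrow> Poly_Mapping.keys (d i) \<subseteq> I"
  shows "finprod (zeon_ring I) (\<lambda>i. zeon_class I (Poly_Mapping.single (d i) 1)) A =
    zeon_class I (Poly_Mapping.single (\<Sum>i\<in>A. d i) 1)"
proof -
  interpret h: ring_hom_cring "mpoly_ring I" "zeon_ring I" "zeon_class I"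
    by (rule zeon_class_hom)
  show ?thesis
    using assms
  proof (induction A rule: finite_induct)
    case empty
    have "zeon_class I 1 = \<one>\<^bsub>zeon_ring I\<^esub>"
      using h.hom_one by (simp add: mpoly_ring_def)
    then show ?case by simp
  next
    case (insert i A)
    have "Poly_Mapping.keys (\<Sum>i\<in>A. d i) \<subseteq> I"
      using insert.prems keys_sum[of d A] by fastforce
    then have "zeon_class I (Poly_Mapping.single (d i) 1) \<otimes>\<^bsub>zeon_ring I\<^esub>
        zeon_class I (Poly_Mapping.single (\<Sum>i\<in>A. d i) 1)
      = zeon_class I
          (Poly_Mapping.single (d i) 1 \<otimes>\<^bsub>mpoly_ring I\<^esub> Poly_Mapping.single (\<Sum>i\<in>A. d i) 1)"
      using insert.prems by (intro h.hom_mult[symmetric] single_in_mpoly_ring) auto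
    also have "\<dots> = zeon_class I (Poly_Mapping.single (\<Sum>i\<in>insert i A. d i) 1)"
      using insert.hyps by (simp add: mpoly_ring_def mult_single)
    finally show ?case
      using insert single_in_mpoly_ring[of _ I 1] by (simp add: Pi_def)
  qed
qed

text \<open>
  The linear span of the monomials with exponent in \<open>M\<close>, taken in the quotient. Only exponents
  supported in \<open>I\<close> contribute, so \<open>M\<close> may be any set.
\<close>

definition zeon_span :: "'x set \<Rightarrow> ('x \<Rightarrow>\<^sub>0 nat) set \<Rightarrow> (('x \<Rightarrow>\<^sub>0 nat) \<Rightarrow>\<^sub>0 complex) set set" where
  "zeon_span I M = zeon_class I ` {p \<in> carrier (mpoly_ring I). Poly_Mapping.keys p \<subseteq> M}"

lemma zeon_span_mult:
  assumes a: "a \<in> zeon_span I M" and b: "b \<in> zeon_span I N"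
    and MN: "\<And>m n. m \<in> M \<Longrightarrow> n \<in> N \<Longrightarrow> m + n \<in> L"
  shows "a \<otimes>\<^bsub>zeon_ring I\<^esub> b \<in> zeon_span I L"
proof -
  interpret h: ring_hom_cring "mpoly_ring I" "zeon_ring I" "zeon_class I"
    by (rule zeon_class_hom)
  obtain p q where p: "p \<in> carrier (mpoly_ring I)" "Poly_Mapping.keys p \<subseteq> M" "a = zeon_class I p"
    and q: "q \<in> carrier (mpoly_ring I)" "Poly_Mapping.keys q \<subseteq> N" "b = zeon_class I q"
    using a b unfolding zeon_span_def by blast
  have times: "p \<otimes>\<^bsub>mpoly_ring I\<^esub> q = p * q"
    by (simp add: mpoly_ring_def)
  have "Poly_Mapping.keys (p * q) \<subseteq> L"
    using keys_mult[of p q] p(2) q(2) MN by blast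
  moreover have "p * q \<in> carrier (mpoly_ring I)"
    using h.R.m_closed[OF p(1) q(1)] by (simp add: times)
  moreover have "a \<otimes>\<^bsub>zeon_ring I\<^esub> b = zeon_class I (p * q)"
    using h.hom_mult[OF p(1) q(1)] p(3) q(3) by (simp add: times)
  ultimately show ?thesis
    unfolding zeon_span_def by blast
qed

lemma subalgebra_zeon_span: "subalgebra (zeon_scalars I) (zeon_span I M) (zeon_ring I)"
proof -
  interpret h: ring_hom_cring "mpoly_ring I" "zeon_ring I" "zeon_class I"
    by (rule zeon_class_hom)
  have "subgroup (zeon_span I M) (add_monoid (zeon_ring I))"
  proof (rule h.S.add.subgroupI)
    show "zeon_span I M \<subseteq> carrier (zeon_ring I)"
      unfolding zeon_span_def by auto
    have "0 \<in> carrier (mpoly_ring I)"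
      by (simp add: mpoly_ring_def)
    then have "zeon_class I 0 \<in> zeon_span I M"
      unfolding zeon_span_def by simp
    then show "zeon_span I M \<noteq> {}" by blast
  next
    fix a assume "a \<in> zeon_span I M"
    then obtain p where p: "p \<in> carrier (mpoly_ring I)" "Poly_Mapping.keys p \<subseteq> M" "a = zeon_class I p"
      unfolding zeon_span_def by blast
    have "- p \<in> carrier (mpoly_ring I)"
      using h.R.a_inv_closed[OF p(1)] p(1) by (simp add: mpoly_ring_a_inv)
    moreover have "\<ominus>\<^bsub>zeon_ring I\<^esub> a = zeon_class I (- p)"
      using h.hom_a_inv[OF p(1)] p(1,3) by (simp add: mpoly_ring_a_inv)
    ultimately show "\<ominus>\<^bsub>zeon_ring I\<^esub> a \<in> zeon_span I M"
      using p(2) unfolding zeon_span_def by simp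
  next
    fix a b assume "a \<in> zeon_span I M" "b \<in> zeon_span I M"
    then obtain p q where p: "p \<in> carrier (mpoly_ring I)" "Poly_Mapping.keys p \<subseteq> M" "a = zeon_class I p"
      and q: "q \<in> carrier (mpoly_ring I)" "Poly_Mapping.keys q \<subseteq> M" "b = zeon_class I q"
      unfolding zeon_span_def by blast
    have plus: "p \<oplus>\<^bsub>mpoly_ring I\<^esub> q = p + q"
      by (simp add: mpoly_ring_def)
    have "Poly_Mapping.keys (p + q) \<subseteq> M"
      using keys_add[of p q] p(2) q(2) by blast
    moreover have "p + q \<in> carrier (mpoly_ring I)"
      using h.R.a_closed[OF p(1) q(1)] by (simp add: plus)
    moreover have "a \<oplus>\<^bsub>zeon_ring I\<^esub> b = zeon_class I (p + q)"
      using h.hom_add[OF p(1) q(1)] p(3) q(3) by (simp add: plus)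
    ultimately show "a \<oplus>\<^bsub>zeon_ring I\<^esub> b \<in> zeon_span I M"
      unfolding zeon_span_def by blast
  qed
  moreover have "k \<otimes>\<^bsub>zeon_ring I\<^esub> a \<in> zeon_span I M"
    if k: "k \<in> zeon_scalars I" and a: "a \<in> zeon_span I M" for k a
  proof (rule zeon_span_mult[OF _ a])
    \<comment> \<open>Scalars are the span of the trivial monomial, so this is a case of multiplying spans.\<close>
    show "k \<in> zeon_span I {0}"
      using k by (auto simp: zeon_scalars_def zeon_span_def mpoly_const_def mpoly_ring_def)
  qed simp
  ultimately show ?thesis
    by (intro subalgebra.intro subalgebra_axioms.intro)
qed

section \<open>Exponents of products of vertex monomials\<close>

definition star_exponent :: "'v set set \<Rightarrow> 'v \<Rightarrow> 'v set \<Rightarrow>\<^sub>0 nat" where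
  "star_exponent E v = (\<Sum>e\<in>{e \<in> E. v \<in> e}. Poly_Mapping.single e 1)"

text \<open>
  A multiset, because products of generators of the algebra may repeat a vertex.
\<close>

definition incidence_exponent :: "'v set set \<Rightarrow> 'v multiset \<Rightarrow> 'v set \<Rightarrow>\<^sub>0 nat" where
  "incidence_exponent E W = (\<Sum>v\<in>#W. star_exponent E v)"

lemma lookup_star_exponent:
  assumes "finite E"
  shows "Poly_Mapping.lookup (star_exponent E v) e = (if e \<in> E \<and> v \<in> e then 1 else 0)"
  using assms by (auto simp: star_exponent_def lookup_sum lookup_single when_def sum.delta')

lemma lookup_incidence_exponent:
  assumes "finite E"
  shows "Poly_Mapping.lookup (incidence_exponent E W) e =
    (if e \<in> E then size (filter_mset (\<lambda>v. v \<in> e) W) else 0)"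
  by (induction W)
    (auto simp: incidence_exponent_def lookup_add lookup_star_exponent[OF assms])

lemma keys_incidence_exponent:
  assumes "finite E"
  shows "Poly_Mapping.keys (incidence_exponent E W) \<subseteq> E"
  by (auto simp: in_keys_iff lookup_incidence_exponent[OF assms] split: if_splits)

lemma keys_star_exponent:
  assumes "finite E"
  shows "Poly_Mapping.keys (star_exponent E v) \<subseteq> E"
  by (auto simp: in_keys_iff lookup_star_exponent[OF assms] split: if_splits)

lemma vertex_monomial_eq:
  assumes "finite E"
  shows "vertex_monomial E v = zeon_class E (Poly_Mapping.single (star_exponent E v) 1)"
  unfolding vertex_monomial_def mpoly_var_def star_exponent_def
  using assms by (intro finprod_zeon_monomials) auto

section \<open>Squarefree products and independent sets\<close>

lemma independence_number_upper:
  assumes "finite V" "independent_set V E S"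
  shows "card S \<le> independence_number V E"
proof -
  have "finite {S. independent_set V E S}"
    by (rule finite_subset[of _ "Pow V"]) (use assms(1) in \<open>auto simp: independent_set_def\<close>)
  then show ?thesis
    unfolding independence_number_def using assms(2) by (intro Max_ge) auto
qed

lemma independence_number_attained:
  assumes "finite V"
  obtains S where "independent_set V E S" "card S = independence_number V E"
proof -
  have "finite {S. independent_set V E S}"
    by (rule finite_subset[of _ "Pow V"]) (use assms in \<open>auto simp: independent_set_def\<close>)
  moreover have "{} \<in> {S. independent_set V E S}"
    by (simp add: independent_set_def)
  ultimately have "independence_number V E \<in> card ` {S. independent_set V E S}"
    unfolding independence_number_def by (intro Max_in) auto
  then show ?thesis using that by force
qed

text \<open>
  A repeated vertex would double the exponent of any edge at it, and two adjacent vertices would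
  double the exponent of the edge between them. So a squarefree product comes from an independent
  set; excluding repetitions is where the absence of isolated vertices is essential.
\<close>

lemma squarefree_incidence_size_le:
  assumes V: "finite V" and E: "E \<subseteq> [V]\<^bsup>2\<^esup>" and no_isolated: "\<forall>v\<in>V. \<exists>e\<in>E. v \<in> e"
    and W: "set_mset W \<subseteq> V" and sqf: "squarefree_exponent (incidence_exponent E W)"
  shows "size W \<le> independence_number V E"
proof -
  have "finite E"
    using finite_subset[OF E finite_imp_finite_nsets[OF V]] .
  then have once: "size (filter_mset (\<lambda>v. v \<in> e) W) \<le> 1" if "e \<in> E" for e
    using sqf that unfolding squarefree_exponent_def by (metis lookup_incidence_exponent)
  have count_le: "count W v \<le> 1" if v: "v \<in># W" for v
  proof -
    obtain e where e: "e \<in> E" "v \<in> e"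
      using no_isolated v W by blast
    have "count W v = count (filter_mset (\<lambda>v. v \<in> e) W) v"
      using e by simp
    also have "\<dots> \<le> 1"
      by (rule order.trans[OF count_le_size once[OF e(1)]])
    finally show ?thesis .
  qed
  have "W = mset_set (set_mset W)"
  proof (rule multiset_eqI)
    fix v show "count W v = count (mset_set (set_mset W)) v"
    proof (cases "v \<in># W")
      case True
      then have "0 < count W v" by simp
      then have "count W v = 1" using count_le[OF True] by linarith
      then show ?thesis using True by simp
    next
      case False
      then show ?thesis by (simp add: not_in_iff)
    qed
  qed
  then have "size W = card (set_mset W)"
    by (metis size_mset_set)
  moreover have "independent_set V E (set_mset W)"
    unfolding independent_set_def
  proof (intro conjI W ballI notI)
    fix u v assume uv: "u \<in># W" "v \<in># W" "{u, v} \<in> E"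
    have "card {u, v} = 2"
      using uv(3) E by (auto simp: nsets_def)
    then have "u \<noteq> v" by auto
    then have "{#u, v#} \<subseteq># filter_mset (\<lambda>w. w \<in> {u, v}) W"
      using uv(1,2) by (auto simp: subseteq_mset_def Suc_le_eq)
    then have "2 \<le> size (filter_mset (\<lambda>w. w \<in> {u, v}) W)"
      using size_mset_mono by fastforce
    then show False
      using once[OF uv(3)] by simp
  qed
  ultimately show ?thesis
    using independence_number_upper[OF V] by metis
qed

text \<open>
  An edge that met the independent set twice would join two of its vertices.
\<close>

lemma independent_set_squarefree:
  assumes V: "finite V" and E: "E \<subseteq> [V]\<^bsup>2\<^esup>" and S: "independent_set V E S"
  shows "squarefree_exponent (\<Sum>v\<in>S. star_exponent E v)"
  unfolding squarefree_exponent_def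
proof
  fix e
  have fin: "finite E" "finite S"
    using finite_subset[OF E finite_imp_finite_nsets[OF V]] S finite_subset[OF _ V]
    by (auto simp: independent_set_def)
  have "Poly_Mapping.lookup (\<Sum>v\<in>S. star_exponent E v) e = card {v \<in> S. e \<in> E \<and> v \<in> e}"
    using fin by (simp add: lookup_sum lookup_star_exponent sum.If_cases Int_def)
  also have "\<dots> \<le> 1"
  proof (rule ccontr)
    assume "\<not> card {v \<in> S. e \<in> E \<and> v \<in> e} \<le> 1"
    then obtain u v where uv: "u \<in> S" "v \<in> S" "e \<in> E" "u \<in> e" "v \<in> e" "u \<noteq> v"
      using fin(2) by (auto simp: card_le_Suc0_iff_eq)
    have "card e = 2" "finite e"
      using uv(3) E by (auto simp: nsets_def)
    then have "{u, v} = e"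
      using uv by (intro card_subset_eq) auto
    then show False
      using uv S by (auto simp: independent_set_def)
  qed
  finally show "Poly_Mapping.lookup (\<Sum>v\<in>S. star_exponent E v) e \<le> 1" .
qed

section \<open>The filtration of the vertex algebra and its nilpotent index\<close>

text \<open>
  The spans of these sets form a decreasing multiplicative filtration whose first term contains
  the vertex algebra. A lower bound on the size, rather than equality, is needed: the algebra
  contains sums of products of different lengths.
\<close>

definition exponents_ge :: "'v set \<Rightarrow> 'v set set \<Rightarrow> nat \<Rightarrow> ('v set \<Rightarrow>\<^sub>0 nat) set" where
  "exponents_ge V E k = {incidence_exponent E W | W. set_mset W \<subseteq> V \<and> k \<le> size W}"

lemma exponents_ge_add:
  assumes "m \<in> exponents_ge V E j" "m' \<in> exponents_ge V E k"
  shows "m + m' \<in> exponents_ge V E (j + k)"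
proof -
  obtain W Y where "set_mset W \<subseteq> V" "j \<le> size W" "m = incidence_exponent E W"
    "set_mset Y \<subseteq> V" "k \<le> size Y" "m' = incidence_exponent E Y"
    using assms unfolding exponents_ge_def by blast
  then show ?thesis
    unfolding exponents_ge_def by (auto simp: incidence_exponent_def intro!: exI[of _ "W + Y"])
qed

lemma exponents_ge_antimono: "j \<le> k \<Longrightarrow> exponents_ge V E k \<subseteq> exponents_ge V E j"
  unfolding exponents_ge_def using order_trans by blast

lemma vertex_monomial_in_span:
  assumes "finite E" "v \<in> V"
  shows "vertex_monomial E v \<in> zeon_span E (exponents_ge V E 1)"
proof -
  have "star_exponent E v = incidence_exponent E {#v#}"
    by (simp add: incidence_exponent_def)
  then have "star_exponent E v \<in> exponents_ge V E 1"
    using assms(2) unfolding exponents_ge_def by fastforce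
  then show ?thesis
    unfolding zeon_span_def vertex_monomial_eq[OF assms(1)]
    using single_in_mpoly_ring[OF keys_star_exponent[OF assms(1)]] by (intro imageI) auto
qed

text \<open>
  The first term of the filtration is itself a subalgebra, closed under multiplication since
  lengths add up and \<open>1 + 1 \<ge> 1\<close>.
\<close>

lemma vertex_algebra_subset_span:
  assumes "finite E"
  shows "vertex_algebra V E \<subseteq> zeon_span E (exponents_ge V E 1)"
proof -
  have "a \<otimes>\<^bsub>zeon_ring E\<^esub> b \<in> zeon_span E (exponents_ge V E 1)"
    if "a \<in> zeon_span E (exponents_ge V E 1)" "b \<in> zeon_span E (exponents_ge V E 1)" for a b
    using that
  proof (rule zeon_span_mult)
    show "m + n \<in> exponents_ge V E 1"
      if "m \<in> exponents_ge V E 1" "n \<in> exponents_ge V E 1" for m n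
      using exponents_ge_add[OF that] exponents_ge_antimono[of 1 "1 + 1"] by auto
  qed
  then show ?thesis
    unfolding vertex_algebra_def generated_algebra_def
    using subalgebra_zeon_span vertex_monomial_in_span[OF assms] by (intro Inter_lower) auto
qed

lemma finprod_in_span:
  assumes "f \<in> {..<k} \<rightarrow> zeon_span E (exponents_ge V E 1)"
  shows "finprod (zeon_ring E) f {..<k} \<in> zeon_span E (exponents_ge V E k)"
proof -
  interpret h: ring_hom_cring "mpoly_ring E" "zeon_ring E" "zeon_class E"
    by (rule zeon_class_hom)
  have carr: "zeon_span E M \<subseteq> carrier (zeon_ring E)" for M
    unfolding zeon_span_def by auto
  show ?thesis
    using assms
  proof (induction k)
    case 0
    have "0 \<in> exponents_ge V E 0"
      unfolding exponents_ge_def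
      by (auto simp: incidence_exponent_def intro!: exI[of _ "{#}"])
    then have "zeon_class E 1 \<in> zeon_span E (exponents_ge V E 0)"
      unfolding zeon_span_def by (intro imageI) (simp add: mpoly_ring_def)
    then show ?case
      using h.hom_one by (simp add: mpoly_ring_def)
  next
    case (Suc k)
    have f: "f \<in> {..<k} \<rightarrow> zeon_span E (exponents_ge V E 1)" "f k \<in> zeon_span E (exponents_ge V E 1)"
      using Suc.prems by auto
    have "f k \<otimes>\<^bsub>zeon_ring E\<^esub> finprod (zeon_ring E) f {..<k} \<in> zeon_span E (exponents_ge V E (Suc k))"
      using f(2) Suc.IH[OF f(1)]
      by (rule zeon_span_mult) (use exponents_ge_add[of _ V E 1 _ k] in simp)
    moreover have "finprod (zeon_ring E) f {..<Suc k} =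
        f k \<otimes>\<^bsub>zeon_ring E\<^esub> finprod (zeon_ring E) f {..<k}"
      unfolding lessThan_Suc using f carr by (intro h.S.finprod_insert) auto
    ultimately show ?case by simp
  qed
qed

lemma products_vanish_above:
  assumes V: "finite V" and E: "E \<subseteq> [V]\<^bsup>2\<^esup>" and no_isolated: "\<forall>v\<in>V. \<exists>e\<in>E. v \<in> e"
    and k: "independence_number V E < k"
  shows "products_vanish (zeon_ring E) (vertex_algebra V E) k"
  unfolding products_vanish_def
proof
  have "finite E"
    using finite_subset[OF E finite_imp_finite_nsets[OF V]] .
  fix f assume "f \<in> {..<k} \<rightarrow> vertex_algebra V E"
  then have "finprod (zeon_ring E) f {..<k} \<in> zeon_span E (exponents_ge V E k)"
    using vertex_algebra_subset_span[OF \<open>finite E\<close>] by (intro finprod_in_span) blast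
  then obtain p where p: "p \<in> carrier (mpoly_ring E)" "Poly_Mapping.keys p \<subseteq> exponents_ge V E k"
    "finprod (zeon_ring E) f {..<k} = zeon_class E p"
    unfolding zeon_span_def by blast
  have "\<not> squarefree_exponent m" if m: "m \<in> exponents_ge V E k" for m
  proof
    assume sqf: "squarefree_exponent m"
    obtain W where W: "set_mset W \<subseteq> V" "k \<le> size W" "m = incidence_exponent E W"
      using m unfolding exponents_ge_def by blast
    have "size W \<le> independence_number V E"
      using sqf unfolding W(3) by (rule squarefree_incidence_size_le[OF V E no_isolated W(1)])
    then show False using W(2) k by linarith
  qed
  then show "finprod (zeon_ring E) f {..<k} = \<zero>\<^bsub>zeon_ring E\<^esub>"
    using p zeon_class_eq_zero_iff[OF p(1)] by auto
qed

lemma products_not_vanish_below: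
  assumes V: "finite V" and E: "E \<subseteq> [V]\<^bsup>2\<^esup>" and k: "k \<le> independence_number V E"
  shows "\<not> products_vanish (zeon_ring E) (vertex_algebra V E) k"
proof
  assume vanish: "products_vanish (zeon_ring E) (vertex_algebra V E) k"
  have "finite E"
    using finite_subset[OF E finite_imp_finite_nsets[OF V]] .
  obtain S where S: "independent_set V E S" "card S = independence_number V E"
    using independence_number_attained[OF V] .
  obtain T where T: "T \<subseteq> S" "card T = k" "finite T"
    using obtain_subset_with_card_n[of k S] k S(2) by metis
  then have T_indep: "independent_set V E T"
    using S(1) unfolding independent_set_def by blast
  obtain g where g: "bij_betw g {..<k} T"
    using ex_bij_betw_nat_finite[OF T(3)] T(2) by (auto simp: atLeast0LessThan)
  have "vertex_monomial E v \<in> vertex_algebra V E" if "v \<in> V" for v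
    using that unfolding vertex_algebra_def generated_algebra_def by blast
  then have "(\<lambda>i. vertex_monomial E (g i)) \<in> {..<k} \<rightarrow> vertex_algebra V E"
    using bij_betwE[OF g] T_indep unfolding independent_set_def by blast
  then have "\<zero>\<^bsub>zeon_ring E\<^esub> = finprod (zeon_ring E) (\<lambda>i. vertex_monomial E (g i)) {..<k}"
    using vanish unfolding products_vanish_def by metis
  also have "\<dots> = zeon_class E (Poly_Mapping.single (\<Sum>i<k. star_exponent E (g i)) 1)"
    unfolding vertex_monomial_eq[OF \<open>finite E\<close>]
    by (intro finprod_zeon_monomials keys_star_exponent[OF \<open>finite E\<close>]) auto
  also have "(\<Sum>i<k. star_exponent E (g i)) = (\<Sum>v\<in>T. star_exponent E v)"
    by (rule sum.reindex_bij_betw[OF g])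
  finally have "zeon_class E (Poly_Mapping.single (\<Sum>v\<in>T. star_exponent E v) 1) = \<zero>\<^bsub>zeon_ring E\<^esub>" ..
  moreover have "Poly_Mapping.keys (\<Sum>v\<in>T. star_exponent E v) \<subseteq> E"
    using keys_sum[of "star_exponent E" T] keys_star_exponent[OF \<open>finite E\<close>] by blast
  ultimately show False
    using independent_set_squarefree[OF V E T_indep]
    by (simp add: zeon_class_eq_zero_iff single_in_mpoly_ring)
qed

theorem corollary2:
  fixes n :: nat and E :: "nat set set"
  assumes graph: "E \<subseteq> [{1..n}]\<^bsup>2\<^esup>"
    and no_isolated: "\<forall>v\<in>{1..n}. \<exists>e\<in>E. v \<in> e"
  shows "nilpotent_algebra (zeon_ring E) (vertex_algebra {1..n} E) \<and>
    nilpotent_index (zeon_ring E) (vertex_algebra {1..n} E) = 1 + independence_number {1..n} E"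
proof
  let ?\<alpha> = "independence_number {1..n} E"
  have vanish: "products_vanish (zeon_ring E) (vertex_algebra {1..n} E) (1 + ?\<alpha>)"
    by (rule products_vanish_above[OF _ graph no_isolated]) auto
  then show "nilpotent_algebra (zeon_ring E) (vertex_algebra {1..n} E)"
    unfolding nilpotent_algebra_def by (intro exI[of _ "1 + ?\<alpha>"]) simp
  show "nilpotent_index (zeon_ring E) (vertex_algebra {1..n} E) = 1 + ?\<alpha>"
    unfolding nilpotent_index_def
  proof (rule Least_equality)
    show "1 \<le> 1 + ?\<alpha> \<and> products_vanish (zeon_ring E) (vertex_algebra {1..n} E) (1 + ?\<alpha>)"
      using vanish by simp
    fix k assume "1 \<le> k \<and> products_vanish (zeon_ring E) (vertex_algebra {1..n} E) k"
    then show "1 + ?\<alpha> \<le> k"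
      using products_not_vanish_below[OF finite_atLeastAtMost graph] by (metis not_less_eq_eq plus_1_eq_Suc)
  qed
qed

end
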